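(* Let $\mathbf{A}=[\underline{A},\overline{A}]$ be an $n\times n$ real interval matrix with midpoint $A^c$. Then: (i) If $A^c\ge 0$, then $\overline{\rho}(\mathbf{A})=\rho(\overline{A})$. (ii) If $\mathbf{A}$ is nonnegative, then $\rho(\mathbf{A})=[\rho(\underline{A}),\rho(\overline{A})]$.
   Context: Inequalities between matrices are entrywise. For $\underline{A}\le\overline{A}$ in $\mathbb{R}^{n\times n}$, the interval matrix is $\mathbf{A}=\{A\in\mathbb{R}^{n\times n} : \underline{A}\le A\le\overline{A}\}$, with midpoint $A^c=\frac12(\underline{A}+\overline{A})$. $\mathbf{A}$ is nonnegative if every $A\in\mathbf{A}$ is entrywise nonnegative (equivalently $\underline{A}\ge 0$). $\rho(A)$ is the spectral radius of $A$, $\rho(\mathbf{A})=\{\rho(A) : A\in\mathbf{A}\}$, and $\overline{\rho}(\mathbf{A})=\max\{\rho(A) : A\in\mathbf{A}\}$ is its upper endpoint. *)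

theory Defs
  imports "Jordan_Normal_Form.Spectral_Radius"
begin

text \<open>The order on matrices is the library's entrywise order, which also requires the
  dimensions to agree.\<close>

definition interval_mat :: "real mat \<Rightarrow> real mat \<Rightarrow> real mat set" where
  "interval_mat L U = {A. L \<le> A \<and> A \<le> U}"

definition midpoint_mat :: "real mat \<Rightarrow> real mat \<Rightarrow> real mat" where
  "midpoint_mat L U = (1/2) \<cdot>\<^sub>m (L + U)"

definition nonneg_mat_real :: "real mat \<Rightarrow> bool" where
  "nonneg_mat_real A \<longleftrightarrow> 0\<^sub>m (dim_row A) (dim_col A) \<le> A"

text \<open>The eigenvalues of a real matrix are taken over the complex numbers.\<close>

definition rho :: "real mat \<Rightarrow> real" where
  "rho A = spectral_radius (map_mat complex_of_real A)"

text \<open>The set below is in general infinite, so its maximum is not \<^const>\<open>Max\<close>, which is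
  specified for finite sets only. \<^const>\<open>Greatest\<close> denotes an attained maximum.\<close>

definition rho_upper :: "real mat set \<Rightarrow> real" where
  "rho_upper \<A> = (GREATEST r. r \<in> rho ` \<A>)"

end

theory Submission
  imports Defs
begin

text \<open>Monotonicity of the spectral radius: if \<open>|B| \<le> A\<close> entrywise and
  \<open>\<rho>(A) < t < \<rho>(B)\<close>, the powers of \<open>A/t\<close> are bounded and dominate those of \<open>B/t\<close>, which
  grow exponentially on an eigenvector. This gives (i), since \<open>A\<^sup>c \<ge> 0\<close> makes
  \<open>|A| \<le> U\<close> for every \<open>A\<close> in the interval, and one inclusion of (ii). The other inclusion follows
  from the intermediate value theorem on the segment from \<open>L\<close> to \<open>U\<close>. Continuity there comes from
  the characteristic polynomials: if \<open>\<mu>\<close> is an eigenvalue of \<open>B\<close> of modulus \<open>\<rho>(B) \<ge> \<rho>(A)\<close>,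
  then \<open>(\<rho>(B) - \<rho>(A))\<^sup>n\<close> is at most \<open>|p\<^sub>A(\<mu>)| = |p\<^sub>A(\<mu>) - p\<^sub>B(\<mu>)|\<close>.\<close>

section \<open>Eigenvalues and powers under scaling\<close>

lemma norm_eigenvalue_le_spectral_radius:
  assumes "A \<in> carrier_mat n n" and "eigenvalue A k"
  shows "norm k \<le> spectral_radius A"
  using spectral_radius_mem_max(2)[OF assms(1) eigenvalue_imp_nonzero_dim[OF assms]] assms(2)
  by (simp add: spectrum_def)

lemma spectral_radius_attained:
  assumes "A \<in> carrier_mat n n" and "n > 0"
  obtains k where "eigenvalue A k" and "norm k = spectral_radius A"
  using spectral_radius_mem_max(1)[OF assms] by (auto simp: spectrum_def)

lemma spectral_radius_nonneg:
  assumes "A \<in> carrier_mat n n" and "n > 0"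
  shows "spectral_radius A \<ge> 0"
  using spectral_radius_attained[OF assms] by (metis norm_ge_zero)

lemma eigenvalue_smultD:
  fixes A :: "'a :: field mat"
  assumes A: "A \<in> carrier_mat n n" and c: "c \<noteq> 0" and ev: "eigenvalue (c \<cdot>\<^sub>m A) k"
  shows "eigenvalue A (k / c)"
proof -
  from ev A obtain v where v: "v \<in> carrier_vec n" "v \<noteq> 0\<^sub>v n" "(c \<cdot>\<^sub>m A) *\<^sub>v v = k \<cdot>\<^sub>v v"
    by (auto simp: eigenvalue_def eigenvector_def)
  have "A *\<^sub>v v = (k / c) \<cdot>\<^sub>v v"
  proof (rule eq_vecI)
    fix i assume "i < dim_vec ((k / c) \<cdot>\<^sub>v v)"
    then have i: "i < n" using v by simp
    have "c * (row A i \<bullet> v) = ((c \<cdot>\<^sub>m A) *\<^sub>v v) $ i"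
      using i A v(1) by simp
    also have "\<dots> = k * v $ i" using v i by simp
    finally show "(A *\<^sub>v v) $ i = ((k / c) \<cdot>\<^sub>v v) $ i"
      using i A v(1) c by (simp add: field_simps)
  qed (use A v in auto)
  then show ?thesis using v A by (auto simp: eigenvalue_def eigenvector_def)
qed

lemma pow_mat_smult:
  fixes A :: "'a :: comm_semiring_1 mat"
  assumes A: "A \<in> carrier_mat n n"
  shows "(c \<cdot>\<^sub>m A) ^\<^sub>m k = c ^ k \<cdot>\<^sub>m (A ^\<^sub>m k)"
proof (induction k)
  case 0
  then show ?case using A by (intro eq_matI) auto
next
  case (Suc k)
  have P: "A ^\<^sub>m k \<in> carrier_mat n n" using A by simp
  have "(c \<cdot>\<^sub>m A) ^\<^sub>m Suc k = (c ^ k \<cdot>\<^sub>m (A ^\<^sub>m k)) * (c \<cdot>\<^sub>m A)"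
    using Suc by simp
  also have "\<dots> = c ^ k \<cdot>\<^sub>m (c \<cdot>\<^sub>m (A ^\<^sub>m k * A))"
    using A by (simp add: mult_smult_assoc_mat[OF P smult_carrier_mat[OF A]] mult_smult_distrib[OF P A])
  also have "\<dots> = c ^ Suc k \<cdot>\<^sub>m (A ^\<^sub>m Suc k)"
    using A P by (intro eq_matI) (auto simp: mult_ac)
  finally show ?case .
qed

text \<open>Dividing by \<open>t\<close> brings the spectral radius below 1, and the Jordan normal
  form then bounds all powers by one constant. The constant may depend on \<open>t\<close> but not
  on the exponent or the entry.\<close>

lemma pow_mat_bound:
  fixes A :: "complex mat"
  assumes A: "A \<in> carrier_mat n n" and n: "n > 0" and t: "spectral_radius A < t"
  obtains c where "\<And>k i j. i < n \<Longrightarrow> j < n \<Longrightarrow> norm ((A ^\<^sub>m k) $$ (i, j)) \<le> c * t ^ k"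
proof -
  have t0: "t > 0" using spectral_radius_nonneg[OF A n] t by linarith
  define s where "s = complex_of_real (1 / t)"
  have s0: "s \<noteq> 0" using t0 by (simp add: s_def)
  have sA: "s \<cdot>\<^sub>m A \<in> carrier_mat n n" using A by simp
  obtain k where k: "eigenvalue (s \<cdot>\<^sub>m A) k" "norm k = spectral_radius (s \<cdot>\<^sub>m A)"
    using spectral_radius_attained[OF sA n] .
  \<comment> \<open>As \<open>s = 1 / t\<close>, the eigenvalue \<open>k\<close> of the scaled
    matrix comes from the eigenvalue \<open>k * t\<close> of \<open>A\<close>.\<close>
  have "norm (k / s) \<le> spectral_radius A"
    using norm_eigenvalue_le_spectral_radius[OF A eigenvalue_smultD[OF A s0 k(1)]] .
  then have "norm k * t \<le> spectral_radius A"
    using t0 by (simp add: s_def norm_divide norm_mult)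
  then have "norm k * t < 1 * t" using t by linarith
  then have "spectral_radius (s \<cdot>\<^sub>m A) < 1"
    using t0 k(2) mult_less_cancel_right_pos[of t "norm k" 1] by simp
  from spectral_radius_jnf_norm_bound_less_1_upper_triangular[OF sA this]
  obtain c where c: "\<And>k. norm_bound ((s \<cdot>\<^sub>m A) ^\<^sub>m k) c" by blast
  show thesis
  proof (rule that)
    fix k i j assume ij: "i < n" "j < n"
    have "norm (((s \<cdot>\<^sub>m A) ^\<^sub>m k) $$ (i, j)) \<le> c"
      using c[of k] ij A unfolding norm_bound_def by simp
    then have "norm ((A ^\<^sub>m k) $$ (i, j)) / t ^ k \<le> c"
      using ij A t0
      by (simp add: pow_mat_smult[OF A] s_def norm_mult norm_divide norm_power power_divide)
    then show "norm ((A ^\<^sub>m k) $$ (i, j)) \<le> c * t ^ k"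
      using t0 by (simp add: field_simps)
  qed
qed

section \<open>Entrywise domination and monotonicity\<close>

lemma norm_pow_mat_le:
  fixes A :: "real mat" and B :: "complex mat"
  assumes A: "A \<in> carrier_mat n n" and B: "B \<in> carrier_mat n n"
    and le: "\<And>i j. i < n \<Longrightarrow> j < n \<Longrightarrow> norm (B $$ (i, j)) \<le> A $$ (i, j)"
    and "i < n" "j < n"
  shows "norm ((B ^\<^sub>m k) $$ (i, j)) \<le> (A ^\<^sub>m k) $$ (i, j)"
  using assms(4-5)
proof (induction k arbitrary: i j)
  case 0
  then show ?case using A B by auto
next
  case (Suc k)
  have P: "A ^\<^sub>m k \<in> carrier_mat n n" "B ^\<^sub>m k \<in> carrier_mat n n" using A B by auto
  have "norm ((B ^\<^sub>m Suc k) $$ (i, j)) = norm (\<Sum>l<n. (B ^\<^sub>m k) $$ (i, l) * B $$ (l, j))"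
    using Suc.prems B P by (simp add: scalar_prod_def atLeast0LessThan)
  also have "\<dots> \<le> (\<Sum>l<n. (A ^\<^sub>m k) $$ (i, l) * A $$ (l, j))"
    by (rule sum_norm_le)
      (use Suc le in \<open>auto simp: norm_mult intro!: mult_mono intro: order_trans[OF norm_ge_zero]\<close>)
  also have "\<dots> = (A ^\<^sub>m Suc k) $$ (i, j)"
    using Suc.prems A P by (simp add: scalar_prod_def atLeast0LessThan)
  finally show ?case .
qed

lemma spectral_radius_le_rho:
  fixes A :: "real mat" and B :: "complex mat"
  assumes n: "n > 0" and A: "A \<in> carrier_mat n n" and B: "B \<in> carrier_mat n n"
    and le: "\<And>i j. i < n \<Longrightarrow> j < n \<Longrightarrow> norm (B $$ (i, j)) \<le> A $$ (i, j)"
  shows "spectral_radius B \<le> rho A"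
proof (rule ccontr)
  assume "\<not> spectral_radius B \<le> rho A"
  \<comment> \<open>The gap below \<open>t\<close> absorbs the polynomial factors that nontrivial
    Jordan blocks contribute to the powers of \<open>A\<close>. The gap above makes the powers of
    \<open>B\<close> outgrow \<open>t ^ k\<close>.\<close>
  then obtain t where t: "rho A < t" "t < spectral_radius B"
    using dense by (metis not_le)
  let ?A = "map_mat complex_of_real A"
  have cA: "?A \<in> carrier_mat n n" using A by simp
  have t0: "t > 0" using spectral_radius_nonneg[OF cA n] t(1) by (simp add: rho_def)
  obtain c where c: "\<And>k i j. i < n \<Longrightarrow> j < n \<Longrightarrow> norm ((?A ^\<^sub>m k) $$ (i, j)) \<le> c * t ^ k"
    using pow_mat_bound[OF cA n] t(1) unfolding rho_def by blast
  have bnd: "norm ((B ^\<^sub>m k) $$ (i, j)) \<le> c * t ^ k" if "i < n" "j < n" for k i j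
  proof -
    have "?A ^\<^sub>m k = map_mat complex_of_real (A ^\<^sub>m k)"
      by (rule of_real_hom.mat_hom_pow[OF A, symmetric])
    then have "norm ((?A ^\<^sub>m k) $$ (i, j)) = \<bar>(A ^\<^sub>m k) $$ (i, j)\<bar>"
      using that A by simp
    then show ?thesis
      using norm_pow_mat_le[OF A B le that, of k] c[OF that, of k] by linarith
  qed
  obtain \<mu> where \<mu>: "eigenvalue B \<mu>" "norm \<mu> = spectral_radius B"
    using spectral_radius_attained[OF B n] .
  then obtain v where ev: "eigenvector B v \<mu>" by (auto simp: eigenvalue_def)
  then have v: "v \<in> carrier_vec n" "v \<noteq> 0\<^sub>v n"
    using B by (auto simp: eigenvector_def)
  then obtain i where i: "i < n" "v $ i \<noteq> 0"
    by (metis carrier_vecD eq_vecI index_zero_vec)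
  \<comment> \<open>Entry \<open>i\<close> of \<open>B ^\<^sub>m k *\<^sub>v v\<close> is at most
    \<open>c * t ^ k\<close> times this 1-norm of \<open>v\<close>, yet it equals
    \<open>\<mu> ^ k * v $ i\<close>.\<close>
  define S where "S = (\<Sum>j<n. norm (v $ j))"
  have growth: "(norm \<mu> / t) ^ k * norm (v $ i) \<le> c * S" for k
  proof -
    have "\<mu> ^ k * v $ i = (B ^\<^sub>m k *\<^sub>v v) $ i"
      using eigenvector_pow[OF B ev, of k] i v by simp
    also have "\<dots> = (\<Sum>j<n. (B ^\<^sub>m k) $$ (i, j) * v $ j)"
      using i v B by (simp add: scalar_prod_def atLeast0LessThan)
    finally have "norm (\<mu> ^ k * v $ i) \<le> (\<Sum>j<n. c * t ^ k * norm (v $ j))"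
      using bnd i by (auto simp: norm_mult intro!: sum_norm_le mult_right_mono)
    then have "norm \<mu> ^ k * norm (v $ i) \<le> c * S * t ^ k"
      by (simp add: norm_mult norm_power S_def sum_distrib_left mult_ac)
    then show ?thesis
      using t0 by (simp add: power_divide field_simps)
  qed
  have "1 < norm \<mu> / t" using t(2) t0 \<mu>(2) by simp
  then obtain k where "c * S / norm (v $ i) < (norm \<mu> / t) ^ k"
    using real_arch_pow by blast
  with growth[of k] i show False
    by (simp add: field_simps)
qed

lemma rho_mono_abs:
  assumes n: "n > 0" and A: "A \<in> carrier_mat n n" and B: "B \<in> carrier_mat n n"
    and le: "\<And>i j. i < n \<Longrightarrow> j < n \<Longrightarrow> \<bar>B $$ (i, j)\<bar> \<le> A $$ (i, j)"
  shows "rho B \<le> rho A"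
  using spectral_radius_le_rho[OF n A, of "map_mat complex_of_real B"] B le
  by (simp add: rho_def[of B])

section \<open>Continuity of the spectral radius along a segment\<close>

lemma spectral_radius_diff_pow_le:
  assumes A: "A \<in> carrier_mat n n" and B: "B \<in> carrier_mat n n" and n: "n > 0"
    and R: "spectral_radius A \<le> R" "spectral_radius B \<le> R"
  shows "\<bar>spectral_radius A - spectral_radius B\<bar> ^ n
    \<le> (\<Sum>k\<le>n. norm (coeff (char_poly A) k - coeff (char_poly B) k) * R ^ k)"
proof -
  \<comment> \<open>The right-hand side is symmetric in the two matrices, so \<open>B\<close> may be
    taken as the one with the larger spectral radius.\<close>
  have wlog: "(spectral_radius B - spectral_radius A) ^ n
      \<le> (\<Sum>k\<le>n. norm (coeff (char_poly A) k - coeff (char_poly B) k) * R ^ k)"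
    if A: "A \<in> carrier_mat n n" and B: "B \<in> carrier_mat n n"
      and le: "spectral_radius A \<le> spectral_radius B" and R: "spectral_radius B \<le> R"
    for A B
  proof -
    obtain \<mu> where \<mu>: "eigenvalue B \<mu>" "norm \<mu> = spectral_radius B"
      using spectral_radius_attained[OF B n] .
    obtain as where as: "char_poly A = (\<Prod>a\<leftarrow>as. [:- a, 1:])" "length as = n"
      using char_poly_factorized[OF A] by blast
    let ?d = "spectral_radius B - spectral_radius A"
    \<comment> \<open>Every root of \<open>char_poly A\<close> lies in the disc of radius
      \<open>spectral_radius A\<close>, while \<open>\<mu>\<close> lies at distance
      \<open>spectral_radius B\<close> from the origin.\<close>
    have le': "?d \<le> norm (\<mu> - a)" if "a \<in> set as" for a
    proof -
      have "poly (char_poly A) a = 0"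
        unfolding as by (rule linear_poly_root[OF that])
      then have "norm a \<le> spectral_radius A"
        using norm_eigenvalue_le_spectral_radius[OF A] eigenvalue_root_char_poly[OF A] by blast
      then show ?thesis using \<mu>(2) norm_triangle_ineq2[of \<mu> a] by linarith
    qed
    \<comment> \<open>The list is generalised so that induction applies while \<open>as\<close>
      stays fixed; at \<open>as\<close> itself the \<open>n\<close> linear factors give the exponent
      \<open>n\<close>.\<close>
    have "?d ^ length xs \<le> norm (poly (\<Prod>a\<leftarrow>xs. [:- a, 1:]) \<mu>)" if "set xs \<subseteq> set as" for xs
      using that
    proof (induction xs)
      case (Cons x xs)
      have "poly (\<Prod>a\<leftarrow>x # xs. [:- a, 1:]) \<mu> = (\<mu> - x) * poly (\<Prod>a\<leftarrow>xs. [:- a, 1:]) \<mu>"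
        by (simp add: algebra_simps)
      moreover have "?d * ?d ^ length xs \<le> norm (\<mu> - x) * norm (poly (\<Prod>a\<leftarrow>xs. [:- a, 1:]) \<mu>)"
        using Cons le le'[of x] by (intro mult_mono) auto
      ultimately show ?case by (simp only: norm_mult length_Cons power_Suc)
    qed simp
    from this[of as] have "?d ^ n \<le> norm (poly (char_poly A) \<mu>)"
      using as by simp
    also have "poly (char_poly A) \<mu> = poly (char_poly A) \<mu> - poly (char_poly B) \<mu>"
      using \<mu>(1) eigenvalue_root_char_poly[OF B] by simp
    \<comment> \<open>Both characteristic polynomials have degree \<open>n\<close>, so their sums
      share one index range.\<close>
    also have "\<dots> = (\<Sum>k\<le>n. (coeff (char_poly A) k - coeff (char_poly B) k) * \<mu> ^ k)"
      using degree_monic_char_poly[OF A] degree_monic_char_poly[OF B]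
      by (simp add: poly_altdef sum_subtractf left_diff_distrib)
    also have "norm \<dots> \<le> (\<Sum>k\<le>n. norm (coeff (char_poly A) k - coeff (char_poly B) k) * R ^ k)"
      using \<mu>(2) R spectral_radius_nonneg[OF B n]
      by (intro sum_norm_le) (auto simp: norm_mult norm_power intro!: mult_left_mono power_mono)
    finally show ?thesis .
  qed
  show ?thesis
  proof (cases "spectral_radius A \<le> spectral_radius B")
    case True
    then show ?thesis using wlog[OF A B True R(2)] by (simp add: abs_minus_commute)
  next
    case False
    then show ?thesis using wlog[OF B A _ R(1)] by (simp add: norm_minus_commute)
  qed
qed

text \<open>Each coefficient is a polynomial in \<open>t\<close>: the characteristic polynomial can
  be formed over the polynomial ring first, since evaluation at \<open>t\<close> is a ring
  homomorphism and commutes with \<open>char_poly\<close>.\<close>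

lemma continuous_coeff_char_poly_segment:
  fixes L D :: "'a :: {comm_ring_1, real_normed_field} mat"
  assumes L: "L \<in> carrier_mat n n" and D: "D \<in> carrier_mat n n"
  shows "continuous_on S (\<lambda>t. coeff (char_poly (L + t \<cdot>\<^sub>m D)) k)"
proof -
  define M where "M = mat n n (\<lambda>ij. [:L $$ ij, D $$ ij:])"
  have M: "M \<in> carrier_mat n n" by (simp add: M_def)
  have "coeff (char_poly (L + t \<cdot>\<^sub>m D)) k = poly (coeff (char_poly M) k) t" for t
  proof -
    have "L + t \<cdot>\<^sub>m D = map_mat (\<lambda>p. poly p t) M"
      using L D by (intro eq_matI) (auto simp: M_def)
    then show ?thesis
      by (simp add: poly_hom.char_poly_hom[OF M])
  qed
  then show ?thesis by (simp add: continuous_on_poly)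
qed

text \<open>The uniform bound \<open>R\<close> keeps the weights \<open>R ^ k\<close> in the
  coefficient estimate fixed as \<open>t\<close> varies, so the estimate tends to 0 with the
  coefficient differences.\<close>

lemma continuous_on_rho_segment:
  assumes n: "n > 0" and L: "L \<in> carrier_mat n n" and D: "D \<in> carrier_mat n n"
    and R: "\<And>t. t \<in> S \<Longrightarrow> rho (L + t \<cdot>\<^sub>m D) \<le> R"
  shows "continuous_on S (\<lambda>t. rho (L + t \<cdot>\<^sub>m D))"
  unfolding continuous_on_def
proof
  fix s assume s: "s \<in> S"
  let ?M = "\<lambda>t::real. map_mat complex_of_real (L + t \<cdot>\<^sub>m D)"
  let ?c = "\<lambda>k t. coeff (char_poly (?M t)) k"
  have M: "?M t \<in> carrier_mat n n" for t using L D by simp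
  have cont: "continuous_on S (?c k)" for k
  proof -
    have "?M t = map_mat complex_of_real L + complex_of_real t \<cdot>\<^sub>m map_mat complex_of_real D" for t
      using L D by (intro eq_matI) auto
    moreover have "continuous_on S (\<lambda>t. coeff (char_poly
        (map_mat complex_of_real L + complex_of_real t \<cdot>\<^sub>m map_mat complex_of_real D)) k)"
      using L D
      \<comment> \<open>The coefficients are continuous in a complex parameter on the whole plane;
        composing with the embedding of the reals restricts them to \<open>S\<close>.\<close>
      by (intro continuous_on_compose2[OF
            continuous_coeff_char_poly_segment[of _ n _ UNIV] continuous_on_of_real_id]) auto
    ultimately show ?thesis by simp
  qed
  have lim: "((\<lambda>t. \<Sum>k\<le>n. norm (?c k t - ?c k s) * R ^ k) \<longlongrightarrow> 0) (at s within S)"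
  proof (rule tendsto_null_sum)
    fix k
    have "(?c k \<longlongrightarrow> ?c k s) (at s within S)"
      using cont s by (auto simp: continuous_on_def)
    from this[THEN LIM_zero]
    show "((\<lambda>t. norm (?c k t - ?c k s) * R ^ k) \<longlongrightarrow> 0) (at s within S)"
      by (intro tendsto_mult_left_zero tendsto_norm_zero)
  qed
  have "((\<lambda>t. \<bar>rho (L + t \<cdot>\<^sub>m D) - rho (L + s \<cdot>\<^sub>m D)\<bar> ^ n) \<longlongrightarrow> 0) (at s within S)"
  proof (rule tendsto_sandwich[OF _ _ tendsto_const lim])
    show "\<forall>\<^sub>F t in at s within S. \<bar>rho (L + t \<cdot>\<^sub>m D) - rho (L + s \<cdot>\<^sub>m D)\<bar> ^ n
        \<le> (\<Sum>k\<le>n. norm (?c k t - ?c k s) * R ^ k)"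
      unfolding eventually_at_filter
      using spectral_radius_diff_pow_le[OF M M n] R s by (auto simp: rho_def)
  qed simp
  \<comment> \<open>As \<open>n > 0\<close>, a quantity whose \<open>n\<close>-th power tends to 0
    tends to 0 itself.\<close>
  then have "((\<lambda>t. rho (L + t \<cdot>\<^sub>m D) - rho (L + s \<cdot>\<^sub>m D)) \<longlongrightarrow> 0) (at s within S)"
    using n by (simp add: power_tendsto_0_iff tendsto_rabs_zero_iff)
  then show "((\<lambda>t. rho (L + t \<cdot>\<^sub>m D)) \<longlongrightarrow> rho (L + s \<cdot>\<^sub>m D)) (at s within S)"
    by (rule LIM_zero_cancel)
qed

section \<open>The interval matrix\<close>

lemma less_eq_mat_iff:
  assumes "A \<in> carrier_mat nr nc"
  shows "A \<le> B \<longleftrightarrow> B \<in> carrier_mat nr nc \<and> (\<forall>i<nr. \<forall>j<nc. A $$ (i, j) \<le> B $$ (i, j))"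
  using assms unfolding less_eq_mat_def carrier_mat_def mem_Collect_eq by metis

theorem theorem19:
  fixes n :: nat and L U :: "real mat"
  assumes "n > 0"
    and "L \<in> carrier_mat n n" and "U \<in> carrier_mat n n"
    and "L \<le> U"
  shows "(nonneg_mat_real (midpoint_mat L U) \<longrightarrow> rho_upper (interval_mat L U) = rho U)
    \<and> ((\<forall>A \<in> interval_mat L U. nonneg_mat_real A) \<longrightarrow>
         rho ` interval_mat L U = {rho L..rho U})"
proof (intro conjI impI)
  note n = assms(1) and L = assms(2) and U = assms(3)
  have LU: "L $$ (i, j) \<le> U $$ (i, j)" if "i < n" "j < n" for i j
    using assms(4) that less_eq_mat_iff[OF L] by blast
  have mem: "A \<in> interval_mat L U \<longleftrightarrow> A \<in> carrier_mat n n \<and>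
      (\<forall>i<n. \<forall>j<n. L $$ (i, j) \<le> A $$ (i, j) \<and> A $$ (i, j) \<le> U $$ (i, j))" for A
    using less_eq_mat_iff[OF L, of A] less_eq_mat_iff[of A n n U] U
    unfolding interval_mat_def mem_Collect_eq by blast
  {
    assume "nonneg_mat_real (midpoint_mat L U)"
    then have mid: "0 \<le> L $$ (i, j) + U $$ (i, j)" if "i < n" "j < n" for i j
      using L U that by (simp add: nonneg_mat_real_def midpoint_mat_def less_eq_mat_def)
    have "rho A \<le> rho U" if A: "A \<in> interval_mat L U" for A
    proof (rule rho_mono_abs[OF n U])
      show "A \<in> carrier_mat n n" using A unfolding mem by simp
      show "\<bar>A $$ (i, j)\<bar> \<le> U $$ (i, j)" if "i < n" "j < n" for i j
      proof -
        have "L $$ (i, j) \<le> A $$ (i, j)" "A $$ (i, j) \<le> U $$ (i, j)"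
          using A that unfolding mem by simp_all
        \<comment> \<open>The midpoint condition says \<open>- U \<le> L\<close>, so each entry of
          \<open>A\<close> lies between those of \<open>- U\<close> and \<open>U\<close>.\<close>
        with mid[OF that] show ?thesis by linarith
      qed
    qed
    moreover have "U \<in> interval_mat L U" using U LU by (simp add: mem)
    ultimately show "rho_upper (interval_mat L U) = rho U"
      unfolding rho_upper_def by (intro Greatest_equality) auto
  next
    assume nonneg: "\<forall>A \<in> interval_mat L U. nonneg_mat_real A"
    have "L \<in> interval_mat L U" using L LU by (simp add: mem)
    then have L0: "0 \<le> L $$ (i, j)" if "i < n" "j < n" for i j
      using nonneg L that by (simp add: nonneg_mat_real_def less_eq_mat_def)
    have bounds: "rho L \<le> rho A \<and> rho A \<le> rho U" if A: "A \<in> interval_mat L U" for A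
    proof (intro conjI rho_mono_abs[OF n])
      show "A \<in> carrier_mat n n" "A \<in> carrier_mat n n" using A unfolding mem by simp_all
      fix i j assume ij: "i < n" "j < n"
      have "L $$ (i, j) \<le> A $$ (i, j)" "A $$ (i, j) \<le> U $$ (i, j)"
        using A ij unfolding mem by simp_all
      \<comment> \<open>Nonnegativity passes from \<open>L\<close> up to \<open>A\<close>, so the
        absolute values disappear and monotonicity applies to both pairs.\<close>
      with L0[OF ij]
      show "\<bar>L $$ (i, j)\<bar> \<le> A $$ (i, j)" "\<bar>A $$ (i, j)\<bar> \<le> U $$ (i, j)" by linarith+
    qed (use L U in auto)
    define D where "D = U - L"
    have D: "D \<in> carrier_mat n n" unfolding D_def using L by (rule minus_carrier_mat)
    have seg: "L + t \<cdot>\<^sub>m D \<in> interval_mat L U" if "t \<in> {0..1}" for t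
    proof -
      have "L $$ (i, j) \<le> (L + t \<cdot>\<^sub>m D) $$ (i, j) \<and> (L + t \<cdot>\<^sub>m D) $$ (i, j) \<le> U $$ (i, j)"
        if ij: "i < n" "j < n" for i j
      proof -
        let ?d = "U $$ (i, j) - L $$ (i, j)"
        have "0 \<le> t * ?d" "t * ?d \<le> ?d"
          using LU[OF ij] \<open>t \<in> {0..1}\<close> by (simp_all add: mult_left_le_one_le)
        moreover have "(L + t \<cdot>\<^sub>m D) $$ (i, j) = L $$ (i, j) + t * ?d"
          using L U ij by (simp add: D_def)
        ultimately show ?thesis by linarith
      qed
      then show ?thesis
        using L D by (simp add: mem)
    qed
    have ends: "L + 0 \<cdot>\<^sub>m D = L" "L + 1 \<cdot>\<^sub>m D = U"
      using L U by (auto simp: D_def intro!: eq_matI)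
    have cont: "continuous_on {0..1} (\<lambda>t. rho (L + t \<cdot>\<^sub>m D))"
      \<comment> \<open>The segment stays in the interval, so monotonicity supplies
        \<open>rho U\<close> as the uniform bound.\<close>
      using bounds[OF seg] by (intro continuous_on_rho_segment[OF n L D, of _ "rho U"]) blast
    show "rho ` interval_mat L U = {rho L..rho U}"
    proof (intro equalityI subsetI)
      fix r assume "r \<in> {rho L..rho U}"
      then have "rho (L + 0 \<cdot>\<^sub>m D) \<le> r" "r \<le> rho (L + 1 \<cdot>\<^sub>m D)"
        unfolding ends by simp_all
      from IVT'[OF this _ cont] obtain t where "0 \<le> t" "t \<le> 1" "rho (L + t \<cdot>\<^sub>m D) = r"
        by auto
      then show "r \<in> rho ` interval_mat L U"
        using seg[of t] by auto
    next
      fix r assume "r \<in> rho ` interval_mat L U"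
      then show "r \<in> {rho L..rho U}" using bounds by auto
    qed
  }
qed

end
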